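(* Let $\mathbb{F}$ be an arbitrary field (of any characteristic, including $2$). Let $\mathcal{L}$ be the four-dimensional $\mathbb{F}$-vector space with basis $\{a,u,v,w\}$ and the bilinear alternating bracket given by $[a,u]=u$, $[a,v]=w$, $[a,w]=v$, all the other brackets of basis elements (apart from those determined by anticommutativity) being $0$. Then $\mathcal{L}$ is a solvable (in fact metabelian) Lie algebra, the decomposition $$\mathcal{L}=\mathcal{L}_\alpha\oplus\mathcal{L}_\beta\oplus\mathcal{L}_\gamma,\qquad \mathcal{L}_\alpha=\mathbb{F}a+\mathbb{F}u,\quad \mathcal{L}_\beta=\mathbb{F}v,\quad \mathcal{L}_\gamma=\mathbb{F}w,$$ indexed by the three-element set $G=\{\alpha,\beta,\gamma\}$, is a Lie grading on $\mathcal{L}$, and this Lie grading is not a semigroup grading; that is, there is no semigroup (commutative or not) $\Gamma$, with operation written as juxtaposition, together with an injective map $\iota\colon G\to \Gamma$ such that $\iota(g)\iota(g')=\iota(g'')$ whenever $g,g',g''\in G$ satisfy $0\ne[\mathcal{L}_g,\mathcal{L}_{g'}]\subseteq\mathcal{L}_{g''}$.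
   Context: A Lie grading on a Lie algebra $\mathcal{L}$ over a field $\mathbb{F}$ is a decomposition of $\mathcal{L}$ into a direct sum of subspaces $\mathcal{L}=\bigoplus_{g\in G}\mathcal{L}_g$ indexed by a set $G$, such that $\mathcal{L}_g\neq 0$ for every $g\in G$, and for any $g,g'\in G$ either $[\mathcal{L}_g,\mathcal{L}_{g'}]=0$ or there exists $g''\in G$ such that $0\neq[\mathcal{L}_g,\mathcal{L}_{g'}]\subseteq\mathcal{L}_{g''}$. Here $[\mathcal{L}_g,\mathcal{L}_{g'}]$ denotes the linear span of all brackets $[x,y]$ with $x\in\mathcal{L}_g$, $y\in\mathcal{L}_{g'}$. A Lie algebra is metabelian if its derived algebra $[\mathcal{L},\mathcal{L}]$ is abelian. *)

theory Defs
  imports Complex_Main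
begin

locale alternating_algebra = vector_space scale
  for scale :: "'f::field \<Rightarrow> 'v::ab_group_add \<Rightarrow> 'v" +
  fixes bracket :: "'v \<Rightarrow> 'v \<Rightarrow> 'v"
  assumes linear_right: "Vector_Spaces.linear scale scale (\<lambda>y. bracket x y)"
    and linear_left: "Vector_Spaces.linear scale scale (\<lambda>x. bracket x y)"
    and alternating: "bracket x x = 0"

locale lie_algebra = alternating_algebra scale bracket
  for scale :: "'f::field \<Rightarrow> 'v::ab_group_add \<Rightarrow> 'v" and bracket :: "'v \<Rightarrow> 'v \<Rightarrow> 'v" +
  assumes jacobi:
    "bracket x (bracket y z) + bracket y (bracket z x) + bracket z (bracket x y) = 0"
begin

definition bracket_span :: "'v set \<Rightarrow> 'v set \<Rightarrow> 'v set" where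
  "bracket_span A B = span {bracket x y | x y. x \<in> A \<and> y \<in> B}"

primrec derived_series :: "nat \<Rightarrow> 'v set" where
  "derived_series 0 = UNIV"
| "derived_series (Suc n) = bracket_span (derived_series n) (derived_series n)"

definition solvable :: bool where
  "solvable \<longleftrightarrow> (\<exists>n. derived_series n = {0})"

definition abelian :: "'v set \<Rightarrow> bool" where
  "abelian A \<longleftrightarrow> (\<forall>x\<in>A. \<forall>y\<in>A. bracket x y = 0)"

definition metabelian :: bool where
  "metabelian \<longleftrightarrow> abelian (bracket_span UNIV UNIV)"

text \<open>The whole space is the internal direct sum of the subspaces \<open>L g\<close>, \<open>g \<in> G\<close>. The index set
  may be infinite, so decompositions are families of finite support; they vanish off \<open>G\<close> to
  make uniqueness meaningful for total functions.\<close>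

definition direct_sum_decomposition :: "'g set \<Rightarrow> ('g \<Rightarrow> 'v set) \<Rightarrow> bool" where
  "direct_sum_decomposition G L \<longleftrightarrow>
    (\<forall>g\<in>G. subspace (L g)) \<and>
    (\<forall>x. \<exists>!f. (\<forall>g\<in>G. f g \<in> L g) \<and> (\<forall>g. g \<notin> G \<longrightarrow> f g = 0) \<and>
      finite {g. f g \<noteq> 0} \<and> x = (\<Sum>g | f g \<noteq> 0. f g))"

definition lie_grading :: "'g set \<Rightarrow> ('g \<Rightarrow> 'v set) \<Rightarrow> bool" where
  "lie_grading G L \<longleftrightarrow>
    direct_sum_decomposition G L \<and>
    (\<forall>g\<in>G. L g \<noteq> {0}) \<and>
    (\<forall>g\<in>G. \<forall>g'\<in>G. bracket_span (L g) (L g') = {0} \<or>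
      (\<exists>g''\<in>G. bracket_span (L g) (L g') \<noteq> {0} \<and> bracket_span (L g) (L g') \<subseteq> L g''))"

text \<open>HOL cannot quantify over types inside a formula, so the carrier of the semigroup is a type
  argument. The grading fails to be a semigroup grading if this predicate is false for every
  type \<open>'s\<close>, that is, if its negation holds with \<open>'s\<close> schematic.\<close>

definition semigroup_grading :: "'s itself \<Rightarrow> 'g set \<Rightarrow> ('g \<Rightarrow> 'v set) \<Rightarrow> bool" where
  "semigroup_grading _ G L \<longleftrightarrow>
    (\<exists>(mult :: 's \<Rightarrow> 's \<Rightarrow> 's) (\<iota> :: 'g \<Rightarrow> 's).
      semigroup mult \<and> inj_on \<iota> G \<and>
      (\<forall>g\<in>G. \<forall>g'\<in>G. \<forall>g''\<in>G.
        bracket_span (L g) (L g') \<noteq> {0} \<and> bracket_span (L g) (L g') \<subseteq> L g'' \<longrightarrow>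
        mult (\<iota> g) (\<iota> g') = \<iota> g''))"

end

locale example_algebra = alternating_algebra scale bracket
  for scale :: "'f::field \<Rightarrow> 'v::ab_group_add \<Rightarrow> 'v" and bracket :: "'v \<Rightarrow> 'v \<Rightarrow> 'v" +
  fixes a u v w :: 'v
  assumes distinct_basis: "distinct [a, u, v, w]"
    and independent_basis: "independent {a, u, v, w}"
    and span_basis: "span {a, u, v, w} = UNIV"
    and bracket_au: "bracket a u = u"
    and bracket_av: "bracket a v = w"
    and bracket_aw: "bracket a w = v"
    and bracket_uv: "bracket u v = 0"
    and bracket_uw: "bracket u w = 0"
    and bracket_vw: "bracket v w = 0"

datatype index = Alpha | Beta | Gamma

context example_algebra
begin

primrec component :: "index \<Rightarrow> 'v set" where
  "component Alpha = span {a, u}"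
| "component Beta = span {v}"
| "component Gamma = span {w}"

end

text \<open>The bracket of \<^locale>\<open>example_algebra\<close> exists on every space with a four-element basis.\<close>

lemma (in vector_space) example_algebra_exists:
  assumes "distinct [a, u, v, w]" "independent {a, u, v, w}" "span {a, u, v, w} = UNIV"
  shows "\<exists>bracket. example_algebra scale bracket a u v w"
proof -
  define r where "r b x = representation {a, u, v, w} x b" for b x
  define d where "d b x y = r a x * r b y - r b x * r a y" for b x y
  define br where "br x y = scale (d u x y) u + scale (d v x y) w + scale (d w x y) v" for x y
  have add: "r b (x + y) = r b x + r b y" for b x y
    using assms(2,3) by (simp add: r_def representation_add)
  have sc: "r b (scale c x) = c * r b x" for b c x
    using assms(2,3) by (simp add: r_def representation_scale)
  have basis: "r b x = (if x = b then 1 else 0)" if "x \<in> {a, u, v, w}" for b x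
    using representation_basis[OF assms(2) that] by (auto simp: r_def)
  have d_add: "d b x (y + z) = d b x y + d b x z" "d b (y + z) x = d b y x + d b z x" for b x y z
    by (simp_all add: d_def add ring_distribs)
  have d_scale: "d b x (scale c y) = c * d b x y" "d b (scale c y) x = c * d b y x" for b c x y
    by (simp_all add: d_def sc right_diff_distrib mult_ac)
  show ?thesis
  proof (intro exI[of _ br], unfold_locales)
    show "br x (y + z) = br x y + br x z" "br (y + z) x = br y x + br z x" for x y z
      by (simp_all add: br_def d_add scale_left_distrib add_ac)
    show "br x (scale c y) = scale c (br x y)" "br (scale c y) x = scale c (br y x)" for x y c
      by (simp_all add: br_def d_scale scale_right_distrib)
    show "br x x = 0" for x by (simp add: br_def d_def)
    show "br a u = u" "br a v = w" "br a w = v" "br u v = 0" "br u w = 0" "br v w = 0"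
      using assms(1) by (auto simp: br_def d_def basis)
  qed (use assms in auto)
qed

end

theory Submission
  imports Defs
begin

text \<open>The span of \<open>u\<close>, \<open>v\<close>, \<open>w\<close> is an abelian ideal of codimension one containing all
  brackets, which gives the Jacobi identity and metabelianity. In a semigroup realising the grading,
  \<open>\<alpha>\<alpha> = \<alpha>\<close>, \<open>\<alpha>\<beta> = \<gamma>\<close> and \<open>\<alpha>\<gamma> = \<beta>\<close>, so that
  \<open>\<gamma> = \<alpha>\<beta> = (\<alpha>\<alpha>)\<beta> = \<alpha>(\<alpha>\<beta>) = \<alpha>\<gamma> = \<beta>\<close>.\<close>

section \<open>Bilinearity and anticommutativity\<close>

context alternating_algebra
begin

lemma bracket_add_right: "bracket x (y + z) = bracket x y + bracket x z"
  by (rule module_hom.add[OF linear_right[unfolded linear_iff_module_hom]])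

lemma bracket_add_left: "bracket (x + y) z = bracket x z + bracket y z"
  by (rule module_hom.add[OF linear_left[unfolded linear_iff_module_hom]])

lemma bracket_scale_right: "bracket x (scale c y) = scale c (bracket x y)"
  by (rule module_hom.scale[OF linear_right[unfolded linear_iff_module_hom]])

lemma bracket_scale_left: "bracket (scale c x) y = scale c (bracket x y)"
  by (rule module_hom.scale[OF linear_left[unfolded linear_iff_module_hom]])

lemma bracket_anticommute: "bracket y x = - bracket x y"
proof -
  \<comment> \<open>Polarisation: after expansion the diagonal terms vanish by
    \<open>alternating\<close>. No division by 2 occurs, so characteristic 2 is covered.\<close>
  have "bracket (x + y) (x + y) = 0" by (rule alternating)
  then have "bracket x y + bracket y x = 0"
    unfolding bracket_add_left bracket_add_right by (simp add: alternating add.commute)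
  then show ?thesis by (simp add: eq_neg_iff_add_eq_0 add.commute)
qed

end

section \<open>Coordinates, the Jacobi identity and metabelianity\<close>

context example_algebra
begin

text \<open>The vector with coordinates (p, q, r, s) in the basis a, u, v, w. Statements about
  vectors thereby become statements about scalars.\<close>

definition comb :: "'f \<Rightarrow> 'f \<Rightarrow> 'f \<Rightarrow> 'f \<Rightarrow> 'v" where
  "comb p q r s = scale p a + scale q u + scale r v + scale s w"

lemma comb_add: "comb p q r s + comb p' q' r' s' = comb (p + p') (q + q') (r + r') (s + s')"
  by (simp add: comb_def scale_left_distrib add_ac)

lemma comb_zero [simp]: "comb 0 0 0 0 = 0"
  by (simp add: comb_def)

lemma scale_comb: "scale c (comb p q r s) = comb (c * p) (c * q) (c * r) (c * s)"
  by (simp add: comb_def scale_right_distrib)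

lemma comb_exhaust:
  obtains p q r s where "x = comb p q r s"
proof -
  have "x \<in> span {a, u, v, w}" using span_basis by simp
  \<comment> \<open>Each use of \<open>span_insert\<close> peels off one basis vector, down to the
    span of the empty set.\<close>
  then obtain p q r s where
    "x - scale p a - scale q u - scale r v - scale s w = 0"
    by (auto simp: span_insert)
  then have "x = comb p q r s" by (simp add: comb_def algebra_simps)
  then show ?thesis by (rule that)
qed

lemma comb_eq_iff:
  "comb p q r s = comb p' q' r' s' \<longleftrightarrow> p = p' \<and> q = q' \<and> r = r' \<and> s = s'"
proof
  \<comment> \<open>The coordinate functionals are linear and dual to the basis, so they recover p,
    q, r, s from the vector.\<close>
  define R where "R x = representation {a, u, v, w} x" for x
  have R: "R (comb p q r s) a = p \<and> R (comb p q r s) u = q \<and>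
      R (comb p q r s) v = r \<and> R (comb p q r s) w = s" for p q r s
  proof -
    have "R (comb p q r s) b = p * R a b + q * R u b + r * R v b + s * R w b" for b
      using independent_basis span_basis
      by (simp add: R_def comb_def representation_add representation_scale)
    then show ?thesis
      using distinct_basis by (simp add: R_def representation_basis[OF independent_basis]) auto
  qed
  assume "comb p q r s = comb p' q' r' s'"
  then show "p = p' \<and> q = q' \<and> r = r' \<and> s = s'" by (metis R)
qed simp

lemma comb_eq_0_iff: "comb p q r s = 0 \<longleftrightarrow> p = 0 \<and> q = 0 \<and> r = 0 \<and> s = 0"
  using comb_eq_iff[of p q r s 0 0 0 0] by simp

text \<open>The last two coordinates swap because the adjoint map of a exchanges v and w. Every
  coordinate is 0 or a 2 by 2 minor involving the coefficients of a, so the bracket vanishes when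
  both of these are 0.\<close>

lemma bracket_comb:
  "bracket (comb p q r s) (comb p' q' r' s') =
    comb 0 (p * q' - q * p') (p * s' - s * p') (p * r' - r * p')"
  using bracket_anticommute[of u a] bracket_anticommute[of v a] bracket_anticommute[of w a]
    bracket_anticommute[of v u] bracket_anticommute[of w u] bracket_anticommute[of w v]
  by (simp add: comb_def bracket_add_left bracket_add_right bracket_scale_left
      bracket_scale_right alternating bracket_au bracket_av bracket_aw bracket_uv bracket_uw
      bracket_vw scale_left_diff_distrib algebra_simps)

lemma is_lie_algebra: "lie_algebra scale bracket"
proof
  fix x y z
  obtain p q r s where x: "x = comb p q r s" by (rule comb_exhaust)
  obtain p' q' r' s' where y: "y = comb p' q' r' s'" by (rule comb_exhaust)
  obtain p'' q'' r'' s'' where z: "z = comb p'' q'' r'' s''" by (rule comb_exhaust)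
  show "bracket x (bracket y z) + bracket y (bracket z x) + bracket z (bracket x y) = 0"
    \<comment> \<open>Each coordinate is a polynomial identity with integer coefficients, hence
      valid in every characteristic.\<close>
    by (simp add: x y z bracket_comb comb_add comb_eq_0_iff algebra_simps)
qed

sublocale lie_algebra scale bracket
  by (rule is_lie_algebra)

lemma subspace_comb_ideal: "subspace {comb 0 q r s | q r s. True}"
  unfolding subspace_def
proof (intro conjI ballI allI)
  show "0 \<in> {comb 0 q r s | q r s. True}" using comb_zero by (metis (mono_tags, lifting) mem_Collect_eq)
qed (force simp: comb_add scale_comb)+

lemma derived_subset: "bracket_span UNIV UNIV \<subseteq> {comb 0 q r s | q r s. True}"
  unfolding bracket_span_def
proof (rule span_minimal[OF _ subspace_comb_ideal], clarify)
  fix x y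
  show "\<exists>q r s. bracket x y = comb 0 q r s \<and> True"
    by (rule comb_exhaust[of x], rule comb_exhaust[of y]) (auto simp: bracket_comb)
qed

lemma is_metabelian: metabelian
  unfolding metabelian_def abelian_def
proof (intro ballI)
  fix x y assume "x \<in> bracket_span UNIV UNIV" "y \<in> bracket_span UNIV UNIV"
  then obtain q r s q' r' s' where "x = comb 0 q r s" "y = comb 0 q' r' s'"
    using derived_subset by blast
  then show "bracket x y = 0" by (simp add: bracket_comb)
qed

end

section \<open>Brackets of subsets and solvability\<close>

context lie_algebra
begin

text \<open>A span is zero exactly when its generators are; this lets coordinates decide whether two
  components commute.\<close>

lemma bracket_span_eq_0_iff:
  "bracket_span A B = {0} \<longleftrightarrow> (\<forall>x\<in>A. \<forall>y\<in>B. bracket x y = 0)"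
proof
  assume eq: "bracket_span A B = {0}"
  show "\<forall>x\<in>A. \<forall>y\<in>B. bracket x y = 0"
  proof (intro ballI)
    fix x y assume "x \<in> A" "y \<in> B"
    then have "bracket x y \<in> bracket_span A B"
      unfolding bracket_span_def by (intro span_base) blast
    then show "bracket x y = 0" using eq by simp
  qed
next
  assume "\<forall>x\<in>A. \<forall>y\<in>B. bracket x y = 0"
  then have "bracket_span A B \<subseteq> {0}"
    unfolding bracket_span_def by (intro span_minimal) auto
  moreover have "0 \<in> bracket_span A B"
    unfolding bracket_span_def by (rule span_zero)
  ultimately show "bracket_span A B = {0}" by blast
qed

lemma bracket_span_subset_iff:
  assumes "subspace S"
  shows "bracket_span A B \<subseteq> S \<longleftrightarrow> (\<forall>x\<in>A. \<forall>y\<in>B. bracket x y \<in> S)"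
proof
  assume "bracket_span A B \<subseteq> S"
  moreover have "bracket x y \<in> bracket_span A B" if "x \<in> A" "y \<in> B" for x y
    unfolding bracket_span_def using that by (intro span_base) blast
  ultimately show "\<forall>x\<in>A. \<forall>y\<in>B. bracket x y \<in> S" by blast
next
  assume "\<forall>x\<in>A. \<forall>y\<in>B. bracket x y \<in> S"
  then show "bracket_span A B \<subseteq> S"
    unfolding bracket_span_def using assms by (intro span_minimal) auto
qed

lemma metabelian_imp_solvable:
  assumes metabelian
  shows solvable
proof -
  \<comment> \<open>The second derived term is the derived algebra bracketed with itself.\<close>
  have "derived_series 2 = {0}"
    using assms by (simp add: numeral_2_eq_2 bracket_span_eq_0_iff metabelian_def abelian_def)
  then show ?thesis unfolding solvable_def by blast
qed

end

section \<open>The grading and its multiplication table\<close>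

context example_algebra
begin

lemma component_Alpha_eq: "component Alpha = {comb p q 0 0 | p q. True}"
  by (auto simp: comb_def span_insert algebra_simps)

lemma component_Beta_eq: "component Beta = {comb 0 0 r 0 | r. True}"
  by (auto simp: comb_def span_insert)

lemma component_Gamma_eq: "component Gamma = {comb 0 0 0 s | s. True}"
  by (auto simp: comb_def span_insert)

lemmas component_eqs = component_Alpha_eq component_Beta_eq component_Gamma_eq

lemma subspace_component: "subspace (component g)"
  by (cases g) simp_all

lemma UNIV_index: "UNIV = {Alpha, Beta, Gamma}"
  using index.exhaust by auto

lemma finite_index_set: "finite (A :: index set)"
  by (rule finite_subset[OF subset_UNIV]) (simp add: UNIV_index)

text \<open>The indices outside the support contribute only zero terms.\<close>

lemma sum_index_support:
  fixes f :: "index \<Rightarrow> 'v"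
  shows "(\<Sum>g | f g \<noteq> 0. f g) = f Alpha + f Beta + f Gamma"
proof -
  have "(\<Sum>g | f g \<noteq> 0. f g) = (\<Sum>g\<in>UNIV. f g)"
    by (rule sum.mono_neutral_left) (auto simp: finite_index_set)
  then show ?thesis by (simp add: UNIV_index add.assoc)
qed

lemma is_direct_sum_decomposition: "direct_sum_decomposition UNIV component"
  unfolding direct_sum_decomposition_def
proof (intro conjI ballI allI)
  fix x
  obtain p q r s where x: "x = comb p q r s" by (rule comb_exhaust)
  \<comment> \<open>The coordinates of x distributed over the three components; uniqueness follows
    by comparing coordinates.\<close>
  let ?f = "case_index (comb p q 0 0) (comb 0 0 r 0) (comb 0 0 0 s)"
  show "\<exists>!f. (\<forall>g\<in>UNIV. f g \<in> component g) \<and> (\<forall>g. g \<notin> UNIV \<longrightarrow> f g = 0) \<and>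
      finite {g. f g \<noteq> 0} \<and> x = (\<Sum>g | f g \<noteq> 0. f g)"
  proof (rule ex1I[of _ ?f])
    have "?f g \<in> component g" for g
      by (cases g) (auto simp: component_eqs simp del: component.simps)
    then show "(\<forall>g\<in>UNIV. ?f g \<in> component g) \<and> (\<forall>g. g \<notin> UNIV \<longrightarrow> ?f g = 0) \<and>
        finite {g. ?f g \<noteq> 0} \<and> x = (\<Sum>g | ?f g \<noteq> 0. ?f g)"
      unfolding sum_index_support by (simp add: x comb_add finite_index_set)
  next
    fix f
    assume f: "(\<forall>g\<in>UNIV. f g \<in> component g) \<and> (\<forall>g. g \<notin> UNIV \<longrightarrow> f g = 0) \<and>
        finite {g. f g \<noteq> 0} \<and> x = (\<Sum>g | f g \<noteq> 0. f g)"
    then have "f Alpha \<in> component Alpha" "f Beta \<in> component Beta" "f Gamma \<in> component Gamma"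
      by blast+
    then obtain p' q' r' s' where f_eq: "f Alpha = comb p' q' 0 0" "f Beta = comb 0 0 r' 0"
        "f Gamma = comb 0 0 0 s'"
      unfolding component_eqs by blast
    have "x = f Alpha + f Beta + f Gamma" using f sum_index_support by metis
    then have "p = p' \<and> q = q' \<and> r = r' \<and> s = s'"
      by (simp add: x f_eq comb_add comb_eq_iff)
    then show "f = ?f"
      using f_eq by (auto simp: fun_eq_iff split: index.split)
  qed
qed (rule subspace_component)

text \<open>\<open>None\<close> encodes a vanishing bracket.\<close>

fun index_mult :: "index \<Rightarrow> index \<Rightarrow> index option" where
  "index_mult Alpha Alpha = Some Alpha"
| "index_mult Alpha Beta = Some Gamma"
| "index_mult Beta Alpha = Some Gamma"
| "index_mult Alpha Gamma = Some Beta"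
| "index_mult Gamma Alpha = Some Beta"
| "index_mult _ _ = None"

lemma bracket_component_None:
  assumes "index_mult g g' = None"
  shows "bracket_span (component g) (component g') = {0}"
  using assms unfolding bracket_span_eq_0_iff
  by (cases g; cases g') (auto simp: component_eqs bracket_comb simp del: component.simps)

lemma bracket_component_Some_nonzero:
  assumes "index_mult g g' = Some g''"
  shows "bracket_span (component g) (component g') \<noteq> {0}"
proof -
  have mem: "comb 1 0 0 0 \<in> component Alpha" "comb 0 1 0 0 \<in> component Alpha"
      "comb 0 0 1 0 \<in> component Beta" "comb 0 0 0 1 \<in> component Gamma"
    unfolding component_eqs by blast+
  \<comment> \<open>One pair of basis vectors for each \<open>Some\<close> entry of
    \<open>index_mult\<close>. For \<open>Alpha\<close> with itself the pair is a, u, since [a, u] =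
    u.\<close>
  have nz: "bracket (comb 1 0 0 0) (comb 0 1 0 0) \<noteq> 0" "bracket (comb 1 0 0 0) (comb 0 0 1 0) \<noteq> 0"
      "bracket (comb 1 0 0 0) (comb 0 0 0 1) \<noteq> 0" "bracket (comb 0 0 1 0) (comb 1 0 0 0) \<noteq> 0"
      "bracket (comb 0 0 0 1) (comb 1 0 0 0) \<noteq> 0"
    by (simp_all add: bracket_comb comb_eq_0_iff)
  show ?thesis
    using assms mem nz unfolding bracket_span_eq_0_iff
    by (cases g; cases g') (simp_all del: component.simps, blast+)
qed

lemma bracket_component_Some_subset:
  assumes "index_mult g g' = Some g''"
  shows "bracket_span (component g) (component g') \<subseteq> component g''"
  using assms unfolding bracket_span_subset_iff[OF subspace_component]
  by (cases g; cases g') (auto simp: component_eqs bracket_comb comb_eq_iff simp del: component.simps)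

lemma is_lie_grading: "lie_grading UNIV component"
  unfolding lie_grading_def
proof (intro conjI ballI is_direct_sum_decomposition)
  fix g
  have "comb 1 0 0 0 \<in> component Alpha" "comb 0 0 1 0 \<in> component Beta"
      "comb 0 0 0 1 \<in> component Gamma"
    unfolding component_eqs by blast+
  moreover have "comb 1 0 0 0 \<noteq> 0" "comb 0 0 1 0 \<noteq> 0" "comb 0 0 0 1 \<noteq> 0"
    by (simp_all add: comb_eq_0_iff)
  ultimately show "component g \<noteq> {0}"
    by (cases g) blast+
next
  fix g g'
  show "bracket_span (component g) (component g') = {0} \<or>
      (\<exists>g''\<in>UNIV. bracket_span (component g) (component g') \<noteq> {0} \<and>
        bracket_span (component g) (component g') \<subseteq> component g'')"
    using bracket_component_None bracket_component_Some_nonzero bracket_component_Some_subset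
    by (cases "index_mult g g'") blast+
qed

lemma not_semigroup_grading: "\<not> semigroup_grading TYPE('s) UNIV component"
proof
  assume "semigroup_grading TYPE('s) UNIV component"
  then obtain mult :: "'s \<Rightarrow> 's \<Rightarrow> 's" and \<iota> where assoc: "semigroup mult" and inj: "inj \<iota>"
    and mult_if: "\<And>g g' g''. bracket_span (component g) (component g') \<noteq> {0} \<Longrightarrow>
      bracket_span (component g) (component g') \<subseteq> component g'' \<Longrightarrow> mult (\<iota> g) (\<iota> g') = \<iota> g''"
    unfolding semigroup_grading_def by blast
  \<comment> \<open>Each \<open>Some\<close> entry of the table forces a product in the
    semigroup.\<close>
  have m: "mult (\<iota> g) (\<iota> g') = \<iota> g''" if "index_mult g g' = Some g''" for g g' g''
    using that
    by (intro mult_if bracket_component_Some_nonzero bracket_component_Some_subset)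
  have "\<iota> Gamma = mult (mult (\<iota> Alpha) (\<iota> Alpha)) (\<iota> Beta)" by (simp add: m)
  also have "\<dots> = mult (\<iota> Alpha) (mult (\<iota> Alpha) (\<iota> Beta))" by (rule semigroup.assoc[OF assoc])
  also have "\<dots> = \<iota> Beta" by (simp add: m)
  \<comment> \<open>Injectivity would give \<open>Gamma = Beta\<close>. The carrier type
    \<open>'s\<close> is arbitrary throughout.\<close>
  finally show False using inj by (auto dest: injD)
qed

end

theorem mainTheorem1:
  fixes scale :: "'f::field \<Rightarrow> 'v::ab_group_add \<Rightarrow> 'v"
    and bracket :: "'v \<Rightarrow> 'v \<Rightarrow> 'v"
    and a u v w :: 'v
  assumes "example_algebra scale bracket a u v w"
  shows "lie_algebra scale bracket
    \<and> lie_algebra.solvable scale bracket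
    \<and> lie_algebra.metabelian scale bracket
    \<and> lie_algebra.lie_grading scale bracket UNIV (example_algebra.component scale a u v w)
    \<and> \<not> lie_algebra.semigroup_grading scale bracket TYPE('s) UNIV
        (example_algebra.component scale a u v w)"
proof -
  interpret example_algebra scale bracket a u v w by (rule assms)
  show ?thesis
    using is_lie_algebra metabelian_imp_solvable[OF is_metabelian] is_metabelian
      is_lie_grading not_semigroup_grading by blast
qed

end
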